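(* Assume: (i) each $g_i:\mathbb{R}^n\to\mathbb{R}$, $i=1,\dots,m$, is convex on $\mathbb{R}^n$, $Y\subseteq\mathbb{R}^n$ is closed and convex, and $X\cap Y$ is nonempty, where $X=\bigcap_{i=1}^m\{x\in\mathbb{R}^n: g_i(x)\le0\}$; (ii) there is a constant $c>0$ such that $\mathrm{dist}^2(x,X\cap Y)\le c\,\mathbb{E}_\omega[(g_\omega^+(x))^2]$ for all $x\in Y$. Then the iterates $v_k,x_k\in Y$ (input and output of the randomized feasibility algorithm described in the context) satisfy, for all $x\in X\cap Y$: (a) $\|x_k-x\|^2\le\|v_k-x\|^2$ surely for all $k\ge1$. (b) If the subgradients $\{d_k^i\}$ are bounded, i.e. $\|d_k^i\|\le M_g$ for all $i$ and $k$, then almost surely for all $k\ge1$, $$\mathbb{E}\left[\|x_k-x\|^2\mid\widetilde{\mathcal F}_{k-1}\right]\le\|v_k-x\|^2-\left((1-q)^{-N_k}-1\right)\mathbb{E}\left[\mathrm{dist}^2(x_k,X\cap Y)\mid\widetilde{\mathcal F}_{k-1}\right],$$ $$\mathbb{E}\left[\mathrm{dist}(x_k,X\cap Y)\mid\widetilde{\mathcal F}_{k-1}\right]\le(1-q)^{\frac{N_k}{2}}\|v_k-x\|,$$ where $\widetilde{\mathcal F}_{k-1}=\mathcal F_{k-1}\cup\{N_k\}$ and $q=\frac{\beta(2-\beta)}{cM_g^2}$, with $\beta\in(0,2)$ the step size of the randomized feasibility algorithm and $c$ the constant in (ii).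
   Context: Norms are Euclidean, $\Pi_Y$ is Euclidean projection onto $Y$, $\mathrm{dist}(x,S)=\min_{z\in S}\|z-x\|$, $g_i^+(x)=\max\{0,g_i(x)\}$. $\omega$ is a random variable taking values in $\{1,\dots,m\}$ with positive probabilities; the constant $c$ may depend on its distribution. Randomized feasibility algorithm with input $(v_k,N_k)$ and deterministic step size $0<\beta<2$: set $z_k^0=v_k$; for $i=1,\dots,N_k$ sample an index $\omega_k^i\in\{1,\dots,m\}$ uniformly, compute a subgradient $d_k^i\in\partial g^+_{\omega_k^i}(z_k^{i-1})$ and set $z_k^i=\Pi_Y\left[z_k^{i-1}-\beta\frac{g^+_{\omega_k^i}(z_k^{i-1})}{\|d_k^i\|^2}d_k^i\right]$; output $x_k=z_k^{N_k}$. The sample size $N_k$ may be deterministic or random, drawn from a distribution $\mathcal{D}_k$ on a discrete set $\mathcal{I}_k\subseteq\mathbb{N}$. The algorithm is called at each iteration $k\ge1$ of an outer (sub)gradient method for minimizing an objective function over $X\cap Y$; the outer method starts at a random point $x_0\in Y$ with $\mathbb{E}[\|x_0\|]<\infty$ and produces $v_k\in Y$ from the previous iterates. The sigma-algebras are $\mathcal F_0=\{x_0\}$ and, for $k\ge1$, $\mathcal F_k=\{x_0\}\cup\{\omega_t^i,N_t: 1\le i\le N_t,\ 1\le t\le k\}$ (meaning those generated by the listed random variables). *)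

theory Defs
  imports "HOL-Probability.Probability"
begin

definition pos_part :: "('a \<Rightarrow> real) \<Rightarrow> 'a \<Rightarrow> real" where
  "pos_part f x = max 0 (f x)"

definition subdifferential :: "('a::real_inner \<Rightarrow> real) \<Rightarrow> 'a \<Rightarrow> 'a set" where
  "subdifferential f x = {d. \<forall>y. f y \<ge> f x + d \<bullet> (y - x)}"

(* The run started at v, with sampled indices j 1, j 2, ... and subgradients d 1, d 2, ...; the
   value at i is z^i.  If the positive part vanishes then so does the step, even when d (Suc i) = 0,
   because r / 0 = 0. *)
primrec feas_iter ::
  "'a::euclidean_space set \<Rightarrow> (nat \<Rightarrow> 'a \<Rightarrow> real) \<Rightarrow> real \<Rightarrow> 'a \<Rightarrow> (nat \<Rightarrow> nat) \<Rightarrow> (nat \<Rightarrow> 'a) \<Rightarrow> nat \<Rightarrow> 'a"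
where
  "feas_iter Y g \<beta> v j d 0 = v"
| "feas_iter Y g \<beta> v j d (Suc i) =
     (let z = feas_iter Y g \<beta> v j d i
      in closest_point Y
           (z - (\<beta> * (pos_part (g (j (Suc i))) z / (norm (d (Suc i)))\<^sup>2)) *\<^sub>R d (Suc i)))"

(* F_k.  The sample s t i belongs to F_k only on the event that it was really drawn, i \<le> N t;
   this is the meaning given to "generated by s t i, i \<le> N t" for a random N t. *)
definition outer_history ::
  "'w measure \<Rightarrow> ('w \<Rightarrow> 'a::euclidean_space) \<Rightarrow> (nat \<Rightarrow> 'w \<Rightarrow> nat) \<Rightarrow> (nat \<Rightarrow> nat \<Rightarrow> 'w \<Rightarrow> nat) \<Rightarrow> nat \<Rightarrow> 'w measure"
where
  "outer_history M x0 N s k = sigma (space M)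
     ({x0 -` B \<inter> space M |B. B \<in> sets borel}
      \<union> {{w \<in> space M. N t w = n} |t n. 1 \<le> t \<and> t \<le> k}
      \<union> {{w \<in> space M. i \<le> N t w \<and> s t i w = j} |t i j. 1 \<le> t \<and> t \<le> k \<and> 1 \<le> i})"

(* Indexed by the outer iteration: for k \<ge> 1 the value at k is F_{k-1} together with N k, the
   algebra written with a tilde and the subscript k-1. *)
definition ext_history ::
  "'w measure \<Rightarrow> ('w \<Rightarrow> 'a::euclidean_space) \<Rightarrow> (nat \<Rightarrow> 'w \<Rightarrow> nat) \<Rightarrow> (nat \<Rightarrow> nat \<Rightarrow> 'w \<Rightarrow> nat) \<Rightarrow> nat \<Rightarrow> 'w measure"
where
  "ext_history M x0 N s k = sigma (space M)
     (sets (outer_history M x0 N s (k - 1)) \<union> {{w \<in> space M. N k w = n} |n. True})"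

(* What is known in outer iteration k after i inner steps. *)
definition inner_history ::
  "'w measure \<Rightarrow> ('w \<Rightarrow> 'a::euclidean_space) \<Rightarrow> (nat \<Rightarrow> 'w \<Rightarrow> nat) \<Rightarrow> (nat \<Rightarrow> nat \<Rightarrow> 'w \<Rightarrow> nat) \<Rightarrow> nat \<Rightarrow> nat \<Rightarrow> 'w measure"
where
  "inner_history M x0 N s k i = sigma (space M)
     (sets (ext_history M x0 N s k) \<union> {{w \<in> space M. s k l w = j} |l j. 1 \<le> l \<and> l \<le> i})"

(* a to the power n/2, with a^0 = 1 also for a = 0, where powr would give 0. *)
definition half_power :: "real \<Rightarrow> nat \<Rightarrow> real" where
  "half_power a n = (if n = 0 then 1 else a powr (real n / 2))"

end

theory Submission
  imports Defs
begin

text \<open>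
  Nonexpansiveness of the projection and the subgradient inequality at a feasible point give, for
  every inner step, a decrease of the squared distance to any feasible point by at least
  \<open>\<beta> (2 - \<beta>) / Mg\<^sup>2\<close> times the squared violation of the sampled constraint.  The sample is independent
  of the past, so the regularity condition bounds the expected violation from below and the expected
  decrease is at least \<open>q\<close> times the squared distance to the feasible set.  Used with the nearest
  feasible point this contracts the expected squared distance by \<open>1 - q\<close>; used with a fixed feasible
  point the decreases sum up, by that contraction, to a geometric series in \<open>(1 - q)\<inverse>\<close>.

  Since the iterates may fail to be square integrable, all expectations are taken over events
  of the initial history on which \<open>N = n\<close> and \<open>norm (v - x) \<le> R\<close>, and the conditional
  expectations are compared by exhausting the space with such events.
\<close>

section \<open>Pathwise descent of one projected step\<close>

text \<open>The projection fixes \<open>y\<close> and is nonexpansive, so it suffices to expand the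
  square before projecting. At \<open>y\<close> the positive part vanishes, hence the subgradient
  inequality bounds the linear term below by the violation \<open>r\<close> at
  \<open>z\<close>.\<close>

lemma feas_step_descent:
  fixes f :: "'a::euclidean_space \<Rightarrow> real"
  assumes Y: "closed Y" "convex Y" and y: "y \<in> Y" "f y \<le> 0"
    and d: "d \<in> subdifferential (pos_part f) z" "norm d \<le> G"
    and step: "0 < \<beta>" "\<beta> < 2"
  shows "(norm (closest_point Y (z - (\<beta> * (pos_part f z / (norm d)\<^sup>2)) *\<^sub>R d) - y))\<^sup>2
           + \<beta> * (2 - \<beta>) / G\<^sup>2 * (pos_part f z)\<^sup>2 \<le> (norm (z - y))\<^sup>2"
proof -
  define r where "r = pos_part f z"
  define t where "t = \<beta> * (r / (norm d)\<^sup>2)"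
  have r0: "r \<ge> 0" by (simp add: r_def pos_part_def)
  have "pos_part f y \<ge> r + d \<bullet> (y - z)"
    using d(1) by (simp add: subdifferential_def r_def)
  moreover have "pos_part f y = 0" using y(2) by (simp add: pos_part_def)
  ultimately have r: "r \<le> d \<bullet> (z - y)" by (simp add: inner_diff_right)
  have "norm (closest_point Y (z - t *\<^sub>R d) - y) \<le> norm (z - t *\<^sub>R d - y)"
    using closest_point_lipschitz[OF Y(2,1), of "z - t *\<^sub>R d" y] closest_point_self[OF y(1)] y(1)
    by (auto simp: dist_norm)
  then have "(norm (closest_point Y (z - t *\<^sub>R d) - y))\<^sup>2 \<le> (norm (z - t *\<^sub>R d - y))\<^sup>2"
    by (simp add: power_mono)
  also have "\<dots> = (norm (z - y))\<^sup>2 - 2 * t * (d \<bullet> (z - y)) + t\<^sup>2 * (norm d)\<^sup>2"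
    unfolding power2_norm_eq_inner by (simp add: algebra_simps inner_commute power2_eq_square)
  also have "\<dots> \<le> (norm (z - y))\<^sup>2 - \<beta> * (2 - \<beta>) / G\<^sup>2 * r\<^sup>2"
  \<comment> \<open>For \<open>d = 0\<close> the bound \<open>r \<le> d \<bullet> (z - y)\<close>
    forces \<open>r = 0\<close>, so both sides agree.\<close>
  proof (cases "d = 0")
    case True
    then show ?thesis using r r0 by (simp add: t_def)
  next
    case False
    then have nd: "0 < norm d" by simp
    have t0: "0 \<le> t" using step r0 by (simp add: t_def)
    have "2 * t * (d \<bullet> (z - y)) \<ge> 2 * t * r" using t0 r by (simp add: mult_left_mono)
    \<comment> \<open>Since \<open>t\<close> times the squared norm of \<open>d\<close> is
      \<open>\<beta> * r\<close>, the linear gain and the quadratic loss combine into the factor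
      \<open>\<beta> * (2 - \<beta>)\<close>.\<close>
    moreover have "2 * t * r - t\<^sup>2 * (norm d)\<^sup>2 = \<beta> * (2 - \<beta>) * r\<^sup>2 / (norm d)\<^sup>2"
      using nd by (simp add: t_def field_simps power2_eq_square)
    moreover have "\<beta> * (2 - \<beta>) * r\<^sup>2 / G\<^sup>2 \<le> \<beta> * (2 - \<beta>) * r\<^sup>2 / (norm d)\<^sup>2"
      using nd d(2) step by (intro divide_left_mono) (auto intro!: power_mono mult_pos_pos)
    ultimately show ?thesis by (simp add: mult.commute mult.left_commute)
  qed
  finally show ?thesis by (simp add: t_def r_def)
qed

section \<open>Integration over an independent sample\<close>

text \<open>Freezing of the sample: the space splits into the finitely many events
  \<open>s w = j\<close>, and each of them is independent of the \<open>H\<close>-measurable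
  function \<open>\<phi> j\<close>, so the integral over it factors.\<close>

lemma (in prob_space) nn_integral_indep_finite_range:
  fixes s :: "'a \<Rightarrow> 'b" and \<phi> :: "'b \<Rightarrow> 'a \<Rightarrow> ennreal"
  assumes H: "subalgebra M H" and s[measurable]: "s \<in> measurable M (count_space UNIV)"
    and indep: "indep_set (sets H) (sets (vimage_algebra (space M) s (count_space UNIV)))"
    and J: "finite J" "\<And>w. w \<in> space M \<Longrightarrow> s w \<in> J"
    and \<phi>: "\<And>j. j \<in> J \<Longrightarrow> \<phi> j \<in> borel_measurable H"
  shows "(\<integral>\<^sup>+w. \<phi> (s w) w \<partial>M)
    = (\<Sum>j\<in>J. ennreal (prob {w \<in> space M. s w = j}) * (\<integral>\<^sup>+w. \<phi> j w \<partial>M))"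
proof -
  define E where "E j = {w \<in> space M. s w = j}" for j
  have E[measurable]: "E j \<in> sets M" for j unfolding E_def by measurable
  have \<phi>M[measurable]: "\<phi> j \<in> borel_measurable M" if "j \<in> J" for j
    using \<phi>[OF that] H by (rule measurable_from_subalg[rotated])
  have *: "(\<integral>\<^sup>+w. indicator (E j) w * \<phi> j w \<partial>M) = ennreal (prob (E j)) * (\<integral>\<^sup>+w. \<phi> j w \<partial>M)"
    if j: "j \<in> J" for j
  proof -
    \<comment> \<open>By independence this density restricts to \<open>H\<close> as a constant
      multiple of the restriction of \<open>M\<close>. The product rule for events thereby extends
      at once to all nonnegative \<open>H\<close>-measurable functions.\<close>
    let ?D = "density M (indicator (E j))"
    have HD: "subalgebra ?D H" using H by (simp add: subalgebra_def)
    have "restr_to_subalg ?D H = scale_measure (ennreal (prob (E j))) (restr_to_subalg M H)"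
    proof (rule measure_eqI)
      show "sets (restr_to_subalg ?D H) = sets (scale_measure (ennreal (prob (E j))) (restr_to_subalg M H))"
        using H HD by (simp add: sets_restr_to_subalg)
      fix B assume "B \<in> sets (restr_to_subalg ?D H)"
      then have B: "B \<in> sets H" using HD by (simp add: sets_restr_to_subalg)
      then have [measurable]: "B \<in> sets M" using H by (auto simp: subalgebra_def)
      have "E j = s -` {j} \<inter> space M" by (auto simp: E_def)
      then have "E j \<in> sets (vimage_algebra (space M) s (count_space UNIV))"
        by (auto intro!: in_vimage_algebra)
      then have "prob (B \<inter> E j) = prob B * prob (E j)"
        using indep B by (intro indep_setD)
      moreover have "emeasure ?D B = emeasure M (B \<inter> E j)"
      proof -
        have "emeasure ?D B = (\<integral>\<^sup>+w. indicator (E j) w * indicator B w \<partial>M)"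
          by (rule emeasure_density) auto
        also have "\<dots> = (\<integral>\<^sup>+w. indicator (B \<inter> E j) w \<partial>M)"
          by (rule nn_integral_cong) (auto simp: indicator_def)
        finally show ?thesis by simp
      qed
      ultimately show "emeasure (restr_to_subalg ?D H) B
          = emeasure (scale_measure (ennreal (prob (E j))) (restr_to_subalg M H)) B"
        using B H HD
        by (simp add: emeasure_restr_to_subalg emeasure_eq_measure ennreal_mult'' mult.commute)
    qed
    then have "(\<integral>\<^sup>+w. \<phi> j w \<partial>?D) = ennreal (prob (E j)) * (\<integral>\<^sup>+w. \<phi> j w \<partial>M)"
      using nn_integral_subalgebra2[OF HD \<phi>[OF j]] nn_integral_subalgebra2[OF H \<phi>[OF j]]
        measurable_in_subalg[OF H \<phi>[OF j]]
      by (simp add: nn_integral_scale_measure)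
    then show ?thesis using j by (simp add: nn_integral_density)
  qed
  have "(\<integral>\<^sup>+w. \<phi> (s w) w \<partial>M) = (\<integral>\<^sup>+w. (\<Sum>j\<in>J. indicator (E j) w * \<phi> j w) \<partial>M)"
  proof (rule nn_integral_cong)
    fix w assume w: "w \<in> space M"
    have "(\<Sum>j\<in>J. indicator (E j) w * \<phi> j w) = (\<Sum>j\<in>J. if s w = j then \<phi> j w else 0)"
      using w by (intro sum.cong) (auto simp: E_def)
    then show "\<phi> (s w) w = (\<Sum>j\<in>J. indicator (E j) w * \<phi> j w)"
      using J w by simp
  qed
  also have "\<dots> = (\<Sum>j\<in>J. \<integral>\<^sup>+w. indicator (E j) w * \<phi> j w \<partial>M)"
    by (intro nn_integral_sum) auto
  finally show ?thesis using * by (simp add: E_def)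
qed

text \<open>Here \<open>\<psi>\<close> and \<open>\<psi>'\<close> are a quantity before and after
  the step, \<open>\<phi> (s w) w\<close> is the gain with the actual sample, and \<open>D\<close>
  bounds the mean gain from below once the sample is averaged out. The gain is integrated in
  \<open>ennreal\<close>, where its finiteness comes from the bound by
  \<open>\<psi> w - \<psi>' w\<close>.\<close>

lemma (in prob_space) expected_descent:
  fixes \<phi> :: "'b \<Rightarrow> 'a \<Rightarrow> real"
  assumes H: "subalgebra M H" and s: "s \<in> measurable M (count_space UNIV)"
    and indep: "indep_set (sets H) (sets (vimage_algebra (space M) s (count_space UNIV)))"
    and J: "finite J" "\<And>w. w \<in> space M \<Longrightarrow> s w \<in> J"
    and A: "A \<in> sets H"
    and \<phi>: "\<And>j. j \<in> J \<Longrightarrow> \<phi> j \<in> borel_measurable H" "\<And>j w. 0 \<le> \<phi> j w"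
    and int: "set_integrable M A \<psi>" "set_integrable M A \<psi>'" "set_integrable M A D"
    and D: "\<And>w. w \<in> A \<Longrightarrow> 0 \<le> D w"
      "\<And>w. w \<in> A \<Longrightarrow> D w \<le> (\<Sum>j\<in>J. prob {w \<in> space M. s w = j} * \<phi> j w)"
    and descent: "\<And>w. w \<in> A \<Longrightarrow> \<psi>' w + \<phi> (s w) w \<le> \<psi> w"
  shows "(LINT w:A|M. \<psi>' w) \<le> (LINT w:A|M. \<psi> w) - (LINT w:A|M. D w)"
proof -
  \<comment> \<open>The indicator of \<open>A\<close> is absorbed into the integrand, which stays
    \<open>H\<close>-measurable because \<open>A\<close> lies in \<open>H\<close>.\<close>
  define e where "e j w = ennreal (indicator A w * \<phi> j w)" for j w
  have [measurable]: "A \<in> sets M" using H A by (auto simp: subalgebra_def)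
  have eH: "e j \<in> borel_measurable H" if "j \<in> J" for j
    using \<phi>(1)[OF that] A unfolding e_def by measurable
  have [measurable]: "e j \<in> borel_measurable M" if "j \<in> J" for j
    using measurable_from_subalg[OF H eH[OF that]] .
  have le: "\<psi>' w \<le> \<psi> w" if "w \<in> A" for w
    using descent[OF that] \<phi>(2)[of "s w" w] by linarith
  have "ennreal (LINT w:A|M. D w) = (\<integral>\<^sup>+w. ennreal (indicator A w * D w) \<partial>M)"
    unfolding set_lebesgue_integral_def using int(3) D(1)
    by (subst nn_integral_eq_integral) (auto simp: set_integrable_def indicator_def intro!: AE_I2)
  also have "\<dots> \<le> (\<integral>\<^sup>+w. (\<Sum>j\<in>J. ennreal (prob {w \<in> space M. s w = j}) * e j w) \<partial>M)"
  proof (rule nn_integral_mono)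
    fix w
    have "ennreal (indicator A w * D w)
        \<le> ennreal (\<Sum>j\<in>J. prob {w \<in> space M. s w = j} * (indicator A w * \<phi> j w))"
      using D(2)[of w] by (intro ennreal_leI) (auto simp: indicator_def)
    also have "\<dots> = (\<Sum>j\<in>J. ennreal (prob {w \<in> space M. s w = j}) * e j w)"
      unfolding e_def using \<phi>(2) by (subst sum_ennreal[symmetric]) (auto simp: ennreal_mult)
    finally show "ennreal (indicator A w * D w)
        \<le> (\<Sum>j\<in>J. ennreal (prob {w \<in> space M. s w = j}) * e j w)" .
  qed
  also have "\<dots> = (\<Sum>j\<in>J. ennreal (prob {w \<in> space M. s w = j}) * (\<integral>\<^sup>+w. e j w \<partial>M))"
    by (subst nn_integral_sum) (auto simp: nn_integral_cmult)
  also have "\<dots> = (\<integral>\<^sup>+w. e (s w) w \<partial>M)"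
    by (rule nn_integral_indep_finite_range[symmetric, OF H s indep J eH])
  also have "\<dots> \<le> (\<integral>\<^sup>+w. ennreal (indicator A w * (\<psi> w - \<psi>' w)) \<partial>M)"
    unfolding e_def using descent
    by (intro nn_integral_mono ennreal_leI) (force simp: indicator_def algebra_simps)
  also have "\<dots> = ennreal (LINT w:A|M. \<psi> w - \<psi>' w)"
    unfolding set_lebesgue_integral_def using set_integral_diff(1)[OF int(1,2)] le
    by (subst nn_integral_eq_integral)
       (auto simp: set_integrable_def indicator_def intro!: AE_I2)
  also have "(LINT w:A|M. \<psi> w - \<psi>' w) = (LINT w:A|M. \<psi> w) - (LINT w:A|M. \<psi>' w)"
    by (rule set_integral_diff(2)[OF int(1,2)])
  finally have "ennreal (LINT w:A|M. D w) \<le> ennreal ((LINT w:A|M. \<psi> w) - (LINT w:A|M. \<psi>' w))" .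
  \<comment> \<open>As \<open>ennreal\<close> truncates negative reals to 0, the inequality returns
    to the reals only with a nonnegative right-hand side.\<close>
  moreover have "0 \<le> (LINT w:A|M. \<psi> w) - (LINT w:A|M. \<psi>' w)"
    using set_integral_mono[OF int(2,1) le] by simp
  ultimately show ?thesis by (simp add: ennreal_le_iff)
qed

section \<open>Real sequences contracted by \<open>1 - q\<close>\<close>

lemma half_power_square: "0 \<le> a \<Longrightarrow> (half_power a n)\<^sup>2 = a ^ n"
proof (cases "n = 0 \<or> a = 0")
  case False
  assume "0 \<le> a"
  with False have "(half_power a n)\<^sup>2 = a powr (real n / 2 + real n / 2)"
    by (simp only: half_power_def power2_eq_square powr_add) simp
  then show ?thesis using False \<open>0 \<le> a\<close> by (simp add: powr_realpow)
qed (auto simp: half_power_def)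

text \<open>
  If \<open>q \<ge> 1\<close>, then \<open>powi\<close> and \<open>half_power\<close> may take junk values at the base \<open>1 - q \<le> 0\<close>; this is
  harmless, because for \<open>n > 0\<close> the contraction then forces \<open>a n = 0\<close>.
\<close>

lemma contraction_telescope:
  fixes a b :: "nat \<Rightarrow> real"
  assumes a: "\<And>i. i \<le> n \<Longrightarrow> 0 \<le> a i"
    and rec_a: "\<And>i. i < n \<Longrightarrow> a (Suc i) \<le> (1 - q) * a i"
    and rec_b: "\<And>i. i < n \<Longrightarrow> b (Suc i) \<le> b i - q * a i"
    and q: "0 \<le> q"
  shows "b n \<le> b 0 - ((1 - q) powi (- int n) - 1) * a n"
    and "a n \<le> (half_power (1 - q) n)\<^sup>2 * a 0"
proof -
  have pow: "(1 - q) powi (- int k) = inverse ((1 - q) ^ k)" for k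
    by (simp add: power_int_minus)
  have "b n \<le> b 0 - ((1 - q) powi (- int n) - 1) * a n
        \<and> a n \<le> (half_power (1 - q) n)\<^sup>2 * a 0"
  proof (cases "q < 1")
    case True
    have "b k \<le> b 0 - (inverse ((1 - q) ^ k) - 1) * a k \<and> a k \<le> (1 - q) ^ k * a 0"
      if "k \<le> n" for k
      using that
    proof (induction k)
      case (Suc k)
      let ?r = "inverse ((1 - q) ^ k)"
      have k: "k < n" using Suc by simp
      have r1: "1 \<le> ?r"
        using True q by (intro one_le_inverse) (auto intro: power_le_one)
      have s: "a (Suc k) / (1 - q) \<le> a k"
        using rec_a[OF k] True by (simp add: field_simps)
      have "b (Suc k) \<le> b k - q * a k" by (rule rec_b[OF k])
      \<comment> \<open>The weight of \<open>a k\<close> is \<open>(?r - 1) + q\<close>, rewritten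
        as \<open>?r - (1 - q)\<close>. It is nonnegative, so \<open>a k\<close> may be replaced by
        the smaller \<open>a (Suc k) / (1 - q)\<close>; dividing the weight by \<open>1 - q\<close>
        gives the next coefficient \<open>inverse ((1 - q) ^ Suc k) - 1\<close>.\<close>
      also have "\<dots> \<le> b 0 - (?r - (1 - q)) * a k"
        using Suc by (simp add: algebra_simps)
      also have "\<dots> \<le> b 0 - (?r - (1 - q)) * (a (Suc k) / (1 - q))"
        using s r1 q by (intro diff_left_mono mult_left_mono) auto
      also have "\<dots> = b 0 - (inverse ((1 - q) ^ Suc k) - 1) * a (Suc k)"
        using True by (simp add: field_simps)
      finally have 1: "b (Suc k) \<le> b 0 - (inverse ((1 - q) ^ Suc k) - 1) * a (Suc k)" .
      note rec_a[OF k]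
      also have "(1 - q) * a k \<le> (1 - q) * ((1 - q) ^ k * a 0)"
        using Suc True by (intro mult_left_mono) auto
      finally have "a (Suc k) \<le> (1 - q) * ((1 - q) ^ k * a 0)" .
      with 1 show ?case by (simp add: mult.assoc)
    qed simp
    from this[of n] True show ?thesis by (simp add: pow half_power_square)
  next
    case q1: False
    show ?thesis
    proof (cases n)
      case 0
      then show ?thesis by (simp add: half_power_def)
    next
      case (Suc n')
      have "a n \<le> (1 - q) * a n'" using rec_a[of n'] Suc by simp
      also have "\<dots> \<le> 0" using q1 a[of n'] Suc by (simp add: mult_nonpos_nonneg)
      finally have an: "a n = 0" using a[of n] by simp
      \<comment> \<open>With \<open>a n = 0\<close> the \<open>powi\<close> term drops out, and only
        the monotonicity of \<open>b\<close> remains to be shown.\<close>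
      have "b k \<le> b 0" if "k \<le> n" for k
        using that
      proof (induction k)
        case (Suc k)
        have "0 \<le> q * a k" using Suc q by (intro mult_nonneg_nonneg a) auto
        with Suc rec_b[of k] show ?case by simp
      qed simp
      then show ?thesis using an a[of 0] by simp
    qed
  qed
  then show "b n \<le> b 0 - ((1 - q) powi (- int n) - 1) * a n"
    and "a n \<le> (half_power (1 - q) n)\<^sup>2 * a 0" by auto
qed

section \<open>Comparison of conditional expectations through set integrals\<close>

text \<open>The set \<open>A\<close> where the inequality fails belongs to \<open>F\<close>. There
  the difference of the conditional expectations is positive, but by \<open>le\<close> its integral
  is at most 0, so \<open>A\<close> is a null set.\<close>

lemma (in sigma_finite_subalgebra) real_cond_exp_mono_set_integral:
  fixes f h :: "'a \<Rightarrow> real"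
  assumes int: "integrable M f" "integrable M h"
    and le: "\<And>A. A \<in> sets F \<Longrightarrow> (LINT w:A|M. f w) \<le> (LINT w:A|M. h w)"
  shows "AE w in M. real_cond_exp M F f w \<le> real_cond_exp M F h w"
proof -
  let ?f = "real_cond_exp M F f" and ?h = "real_cond_exp M F h"
  define A where "A = {w \<in> space F. ?h w < ?f w}"
  have A: "A \<in> sets F" unfolding A_def by measurable
  then have AM[measurable]: "A \<in> sets M" using subalg by (auto simp: subalgebra_def)
  have intf: "set_integrable M A ?f" "set_integrable M A ?h"
    unfolding set_integrable_def
    by (rule integrable_mult_indicator[OF AM real_cond_exp_int(1)[OF int(1)]],
        rule integrable_mult_indicator[OF AM real_cond_exp_int(1)[OF int(2)]])
  define G :: "'a \<Rightarrow> real" where "G w = indicator A w * (?f w - ?h w)" for w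
  have G0: "0 \<le> G w" for w by (simp add: G_def A_def indicator_def)
  have intG: "integrable M G"
    using set_integral_diff(1)[OF intf] by (simp add: G_def[abs_def] set_integrable_def)
  have "(\<integral>w. G w \<partial>M) = (LINT w:A|M. ?f w) - (LINT w:A|M. ?h w)"
    using set_integral_diff(2)[OF intf] by (simp add: G_def set_lebesgue_integral_def)
  also have "\<dots> \<le> 0"
    using le[OF A] real_cond_exp_intA[OF int(1) A] real_cond_exp_intA[OF int(2) A] by simp
  finally have "(\<integral>w. G w \<partial>M) = 0"
    using Bochner_Integration.integral_nonneg[of M G] G0 by (simp add: antisym)
  then have "AE w in M. G w = 0"
    using integral_nonneg_eq_0_iff_AE[OF intG] G0 by auto
  then show ?thesis using AE_space
  proof eventually_elim
    case (elim w)
    then have "w \<in> space F" using subalg by (simp add: subalgebra_def)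
    with elim(1) show ?case by (auto simp: G_def A_def not_less split: split_indicator_asm)
  qed
qed

lemma (in finite_measure) set_integrable_bounded:
  fixes f :: "'a \<Rightarrow> real"
  assumes "A \<in> sets M" "f \<in> borel_measurable M" "\<And>w. w \<in> A \<Longrightarrow> \<bar>f w\<bar> \<le> B"
  shows "set_integrable M A f"
  unfolding set_integrable_def
proof (rule integrable_const_bound)
  show "AE w in M. norm (indicator A w *\<^sub>R f w) \<le> \<bar>B\<bar>"
  proof (rule AE_I2)
    fix w
    show "norm (indicator A w *\<^sub>R f w) \<le> \<bar>B\<bar>"
      using assms(3)[of w] by (cases "w \<in> A") auto
  qed
qed (use assms(1,2) in measurable)

section \<open>One outer iteration: measurability and pathwise estimates\<close>

text \<open>
  A single outer iteration: \<open>H i\<close> is the history after \<open>i\<close> inner steps, so that \<open>H 0\<close> already contains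
  the sample size \<open>N\<close>, and \<open>S\<close> is the feasible set \<open>X \<inter> Y\<close>.
\<close>

locale feasibility_run = prob_space M for M :: "'w measure" +
  fixes H :: "nat \<Rightarrow> 'w measure"
    and g :: "nat \<Rightarrow> 'a::euclidean_space \<Rightarrow> real"
    and J :: "nat set" and \<pi> :: "nat \<Rightarrow> real" and Y S :: "'a set" and c \<beta> :: real
    and N :: "'w \<Rightarrow> nat" and s :: "nat \<Rightarrow> 'w \<Rightarrow> nat"
    and d :: "nat \<Rightarrow> 'w \<Rightarrow> 'a" and v xk :: "'w \<Rightarrow> 'a"
  assumes g_convex: "\<And>j. j \<in> J \<Longrightarrow> convex_on UNIV (g j)"
    and Y: "closed Y" "convex Y"
    and S_eq: "S = {x \<in> Y. \<forall>j\<in>J. g j x \<le> 0}" and S_ne: "S \<noteq> {}"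
    and c_pos: "0 < c"
    and step: "0 < \<beta>" "\<beta> < 2"
    and J: "finite J"
    and regularity: "\<And>x. x \<in> Y \<Longrightarrow> (infdist x S)\<^sup>2 \<le> c * (\<Sum>j\<in>J. \<pi> j * (pos_part (g j) x)\<^sup>2)"
    and H: "\<And>i. subalgebra M (H i)"
    and H_mono: "\<And>i. sets (H i) \<subseteq> sets (H (Suc i))"
    and N_meas: "N \<in> measurable (H 0) (count_space UNIV)"
    and v_meas: "v \<in> borel_measurable (H 0)"
    and v_in: "\<And>w. w \<in> space M \<Longrightarrow> v w \<in> Y"
    and s_meas: "\<And>i. s (Suc i) \<in> measurable (H (Suc i)) (count_space UNIV)"
    and s_in: "\<And>i w. w \<in> space M \<Longrightarrow> s (Suc i) w \<in> J"
    and s_prob: "\<And>i j. j \<in> J \<Longrightarrow> prob {w \<in> space M. s (Suc i) w = j} = \<pi> j"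
    and s_indep: "\<And>i. indep_set (sets (H i))
          (sets (vimage_algebra (space M) (s (Suc i)) (count_space UNIV)))"
    and d_meas: "\<And>i. d (Suc i) \<in> borel_measurable (H (Suc i))"
    and d_subgrad: "\<And>i w. w \<in> space M \<Longrightarrow> i < N w \<Longrightarrow>
          d (Suc i) w \<in> subdifferential (pos_part (g (s (Suc i) w)))
            (feas_iter Y g \<beta> (v w) (\<lambda>l. s l w) (\<lambda>l. d l w) i)"
    and xk_eq: "\<And>w. w \<in> space M \<Longrightarrow>
          xk w = feas_iter Y g \<beta> (v w) (\<lambda>l. s l w) (\<lambda>l. d l w) (N w)"
begin

text \<open>The run is continued beyond \<open>N w\<close>, where \<open>d_subgrad\<close> says
  nothing. This makes each \<open>z i\<close> a total function adapted to \<open>H i\<close>, from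
  which the output is selected at the random index \<open>N w\<close>.\<close>

definition z :: "nat \<Rightarrow> 'w \<Rightarrow> 'a" where
  "z i w = feas_iter Y g \<beta> (v w) (\<lambda>l. s l w) (\<lambda>l. d l w) i"

lemma z_0: "z 0 w = v w"
  by (simp add: z_def)

lemma z_Suc: "z (Suc i) w = closest_point Y (z i w
    - (\<beta> * (pos_part (g (s (Suc i) w)) (z i w) / (norm (d (Suc i) w))\<^sup>2)) *\<^sub>R d (Suc i) w)"
  by (simp add: z_def Let_def)

lemma space_H: "space (H i) = space M"
  using H[of i] by (simp add: subalgebra_def)

lemma meas_Suc: "f \<in> measurable (H i) K \<Longrightarrow> f \<in> measurable (H (Suc i)) K"
  using H_mono[of i] by (auto simp: measurable_def space_H)

lemma sets_0: "A \<in> sets (H 0) \<Longrightarrow> A \<in> sets (H i)"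
  by (induction i) (use H_mono in blast)+

lemma sets_0_M: "A \<in> sets (H 0) \<Longrightarrow> A \<in> sets M"
  using H[of 0] by (auto simp: subalgebra_def)

lemma g_cont: "j \<in> J \<Longrightarrow> continuous_on UNIV (g j)"
  using convex_on_continuous[OF open_UNIV g_convex] .

lemma pos_part_meas: "j \<in> J \<Longrightarrow> pos_part (g j) \<in> borel_measurable borel"
  unfolding pos_part_def[abs_def]
  by (intro borel_measurable_continuous_onI continuous_intros continuous_on_subset[OF g_cont]) auto

lemma closed_S: "closed S"
proof -
  have "S = Y \<inter> (\<Inter>j\<in>J. {x. g j x \<le> 0})" by (auto simp: S_eq)
  moreover have "closed {x. g j x \<le> 0}" if "j \<in> J" for j
    by (intro closed_Collect_le continuous_intros g_cont that)
  ultimately show ?thesis using Y by auto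
qed

lemma infdist_meas [measurable]: "(\<lambda>y. infdist y S) \<in> borel_measurable borel"
  by (intro borel_measurable_continuous_onI continuous_intros)

lemma Y_ne: "Y \<noteq> {}"
  using S_ne by (auto simp: S_eq)

lemma z_in: "w \<in> space M \<Longrightarrow> z i w \<in> Y"
  by (cases i) (auto simp: z_0 z_Suc v_in intro!: closest_point_in_set Y Y_ne)

lemma z_meas: "z i \<in> borel_measurable (H i)"
proof (induction i)
  case 0
  then show ?case using v_meas by (simp add: z_0[abs_def])
next
  case (Suc i)
  have [measurable]: "z i \<in> borel_measurable (H (Suc i))" "d (Suc i) \<in> borel_measurable (H (Suc i))"
    using meas_Suc[OF Suc] d_meas by auto
  \<comment> \<open>Continuity, and hence measurability, of \<open>g j\<close> is known only for
    \<open>j\<close> in \<open>J\<close>; the composition with a random index therefore needs the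
    sample to take values in \<open>J\<close>.\<close>
  have "s (Suc i) \<in> measurable (H (Suc i)) (count_space J)"
    using measurable_sets[OF s_meas[of i]] s_in
    by (intro measurableI) (auto simp: space_H)
  from measurable_compose_countable'[where f = "\<lambda>j w. pos_part (g j) (z i w)",
      OF measurable_compose[OF meas_Suc[OF Suc] pos_part_meas] this countable_finite[OF J]]
  have [measurable]: "(\<lambda>w. pos_part (g (s (Suc i) w)) (z i w)) \<in> borel_measurable (H (Suc i))" .
  have [measurable]: "closest_point Y \<in> borel_measurable borel"
    by (intro borel_measurable_continuous_onI continuous_on_closest_point Y Y_ne)
  show ?case unfolding z_Suc[abs_def] by measurable
qed

lemma descent:
  assumes "w \<in> space M" "i < N w" "x \<in> S" "norm (d (Suc i) w) \<le> G"
  shows "(norm (z (Suc i) w - x))\<^sup>2 + \<beta> * (2 - \<beta>) / G\<^sup>2 * (pos_part (g (s (Suc i) w)) (z i w))\<^sup>2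
    \<le> (norm (z i w - x))\<^sup>2"
  unfolding z_Suc
proof (rule feas_step_descent[OF Y _ _ _ assms(4) step])
  show "x \<in> Y" "g (s (Suc i) w) x \<le> 0"
    using assms(3) s_in[OF assms(1)] by (auto simp: S_eq)
  show "d (Suc i) w \<in> subdifferential (pos_part (g (s (Suc i) w))) (z i w)"
    unfolding z_def by (rule d_subgrad[OF assms(1,2)])
qed

text \<open>Taking \<open>G\<close> in \<open>descent\<close> to be the norm of the current
  subgradient gives monotonicity without any uniform bound on the subgradients. This yields the sure
  estimate and, later, integrability on suitable events.\<close>

lemma norm_z_le:
  assumes "w \<in> space M" "i \<le> N w" "x \<in> S"
  shows "norm (z i w - x) \<le> norm (v w - x)"
  using assms(2)
proof (induction i)
  case (Suc i)
  have "(norm (z (Suc i) w - x))\<^sup>2 \<le> (norm (z i w - x))\<^sup>2"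
  proof (rule order_trans[OF _ descent])
    show "(norm (z (Suc i) w - x))\<^sup>2 \<le> (norm (z (Suc i) w - x))\<^sup>2
        + \<beta> * (2 - \<beta>) / (norm (d (Suc i) w))\<^sup>2 * (pos_part (g (s (Suc i) w)) (z i w))\<^sup>2"
      using step by simp
  qed (use assms Suc in auto)
  then have "norm (z (Suc i) w - x) \<le> norm (z i w - x)"
    by (rule power2_le_imp_le) simp
  also have "\<dots> \<le> norm (v w - x)" using Suc by simp
  finally show ?case .
qed (simp add: z_0)

lemma infdist_le_norm: "x \<in> S \<Longrightarrow> infdist y S \<le> norm (y - x)"
  using infdist_le[of x S y] by (simp add: dist_norm)

text \<open>The nearest feasible point to \<open>z i w\<close> serves as comparison point for both
  iterates. It varies with \<open>w\<close>, but the descent is pathwise, so no measurable choice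
  has to be made.\<close>

lemma descent_infdist:
  assumes "w \<in> space M" "i < N w" "norm (d (Suc i) w) \<le> G"
  shows "(infdist (z (Suc i) w) S)\<^sup>2 + \<beta> * (2 - \<beta>) / G\<^sup>2 * (pos_part (g (s (Suc i) w)) (z i w))\<^sup>2
    \<le> (infdist (z i w) S)\<^sup>2"
proof -
  obtain x where x: "x \<in> S" "infdist (z i w) S = dist (z i w) x"
    by (rule infdist_attains_inf[OF closed_S S_ne])
  have "(infdist (z (Suc i) w) S)\<^sup>2 \<le> (norm (z (Suc i) w - x))\<^sup>2"
    by (intro power_mono infdist_le_norm x infdist_nonneg)
  then show ?thesis using descent[OF assms(1,2) x(1) assms(3)] x by (simp add: dist_norm)
qed

lemma xk_z: "w \<in> space M \<Longrightarrow> xk w = z (N w) w"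
  by (simp add: xk_eq z_def)

lemma xk_meas: "xk \<in> borel_measurable M"
proof -
  have "(\<lambda>w. z (N w) w) \<in> borel_measurable M"
    by (rule measurable_compose_countable[OF measurable_from_subalg[OF H z_meas]
          measurable_from_subalg[OF H N_meas]])
  then show ?thesis by (subst measurable_cong[OF xk_z])
qed

section \<open>Expectation bounds for one outer iteration\<close>

text \<open>On \<open>A\<close> the number of steps is the constant \<open>n\<close>, and by
  \<open>norm_z_le\<close> all iterates up to \<open>n\<close> stay within \<open>R\<close> of
  \<open>x\<close>. Every integral is thus finite, and the recursion can be run for exactly
  \<open>n\<close> steps.\<close>

lemma integral_bounds:
  fixes Mg :: real
  defines "q \<equiv> \<beta> * (2 - \<beta>) / (c * Mg\<^sup>2)"
  assumes Mg: "\<And>w i. w \<in> space M \<Longrightarrow> i < N w \<Longrightarrow> norm (d (Suc i) w) \<le> Mg"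
    and x: "x \<in> S" and A: "A \<in> sets (H 0)"
    and A_sub: "A \<subseteq> {w \<in> space M. N w = n \<and> norm (v w - x) \<le> R}"
  shows "(LINT w:A|M. (norm (xk w - x))\<^sup>2) \<le> (LINT w:A|M. (norm (v w - x))\<^sup>2)
          - ((1 - q) powi (- int n) - 1) * (LINT w:A|M. (infdist (xk w) S)\<^sup>2)" (is ?b)
    and "(LINT w:A|M. (infdist (xk w) S)\<^sup>2)
          \<le> (half_power (1 - q) n)\<^sup>2 * (LINT w:A|M. (infdist (v w) S)\<^sup>2)" (is ?a)
proof -
  have A_M: "A \<in> sets M" by (rule sets_0_M[OF A])
  have zM[measurable]: "z i \<in> borel_measurable M" for i
    by (rule measurable_from_subalg[OF H z_meas])
  have R: "norm (z i w - x) \<le> R" "infdist (z i w) S \<le> R" if "w \<in> A" "i \<le> n" for i w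
    using norm_z_le[of w i x] infdist_le_norm[OF x, of "z i w"] that x A_sub by force+
  have int_norm: "set_integrable M A (\<lambda>w. (norm (z i w - x))\<^sup>2)" if "i \<le> n" for i
    using R that by (intro set_integrable_bounded[OF A_M, where B = "R\<^sup>2"]) (auto intro!: power_mono)
  have int_dist: "set_integrable M A (\<lambda>w. (infdist (z i w) S)\<^sup>2)" if "i \<le> n" for i
    using R that
    by (intro set_integrable_bounded[OF A_M, where B = "R\<^sup>2"]) (auto intro!: power_mono infdist_nonneg)
  define \<gamma> where "\<gamma> = \<beta> * (2 - \<beta>) / Mg\<^sup>2"
  have \<gamma>: "0 \<le> \<gamma>" using step by (simp add: \<gamma>_def)
  \<comment> \<open>The pathwise gain factor \<open>\<gamma>\<close> becomes \<open>q\<close> after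
    division by the regularity constant. If \<open>Mg = 0\<close>, division by zero makes both of
    them 0.\<close>
  have q: "q = \<gamma> / c" by (simp add: q_def \<gamma>_def mult.commute)
  define \<phi> where "\<phi> i j w = \<gamma> * (pos_part (g j) (z i w))\<^sup>2" for i j w
  \<comment> \<open>Stated for arbitrary \<open>\<psi>\<close> and \<open>\<psi>'\<close>, since it
    is used both for the squared distance to \<open>x\<close> and for the squared distance to
    \<open>S\<close>.\<close>
  have rec: "(LINT w:A|M. \<psi>' w) \<le> (LINT w:A|M. \<psi> w) - q * (LINT w:A|M. (infdist (z i w) S)\<^sup>2)"
    if i: "i < n" and \<psi>: "set_integrable M A \<psi>" "set_integrable M A \<psi>'"
      and le: "\<And>w. w \<in> A \<Longrightarrow> \<psi>' w + \<phi> i (s (Suc i) w) w \<le> \<psi> w" for i \<psi> \<psi>'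
  proof -
    have "(LINT w:A|M. \<psi>' w) \<le> (LINT w:A|M. \<psi> w) - (LINT w:A|M. q * (infdist (z i w) S)\<^sup>2)"
    proof (rule expected_descent[OF H[of i] measurable_from_subalg[OF H s_meas] s_indep J s_in
            sets_0[OF A] _ _ \<psi>, where \<phi> = "\<phi> i"])
      show "\<phi> i j \<in> borel_measurable (H i)" if "j \<in> J" for j
        unfolding \<phi>_def[abs_def] using measurable_compose[OF z_meas pos_part_meas[OF that]]
        by (intro borel_measurable_times borel_measurable_power) auto
      show "\<psi>' w + \<phi> i (s (Suc i) w) w \<le> \<psi> w" if "w \<in> A" for w
        by (rule le[OF that])
      show "0 \<le> \<phi> i j w" for j w using \<gamma> by (simp add: \<phi>_def)
      show "set_integrable M A (\<lambda>w. q * (infdist (z i w) S)\<^sup>2)"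
        using int_dist[of i] i by (intro set_integrable_mult_right) auto
      show "0 \<le> q * (infdist (z i w) S)\<^sup>2" for w using \<gamma> c_pos by (simp add: q)
      show "q * (infdist (z i w) S)\<^sup>2 \<le> (\<Sum>j\<in>J. prob {w \<in> space M. s (Suc i) w = j} * \<phi> i j w)"
        if "w \<in> A" for w
      proof -
        have "z i w \<in> Y" using that A_sub by (intro z_in) auto
        then have "q * (infdist (z i w) S)\<^sup>2 \<le> q * (c * (\<Sum>j\<in>J. \<pi> j * (pos_part (g j) (z i w))\<^sup>2))"
          using \<gamma> c_pos by (intro mult_left_mono regularity) (auto simp: q)
        also have "\<dots> = (\<Sum>j\<in>J. \<pi> j * \<phi> i j w)"
          using c_pos by (simp add: q \<phi>_def sum_distrib_left mult.left_commute)
        finally show ?thesis by (simp add: s_prob)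
      qed
    qed
    then show ?thesis by simp
  qed
  define a where "a i = (LINT w:A|M. (infdist (z i w) S)\<^sup>2)" for i
  define b where "b i = (LINT w:A|M. (norm (z i w - x))\<^sup>2)" for i
  have "b (Suc i) \<le> b i - q * a i" if "i < n" for i
    unfolding a_def b_def using that descent[of _ i x Mg] Mg x A_sub
    by (intro rec int_norm) (force simp: \<phi>_def \<gamma>_def)+
  moreover have "a (Suc i) \<le> (1 - q) * a i" if "i < n" for i
  proof -
    have "a (Suc i) \<le> a i - q * a i"
      unfolding a_def using that descent_infdist[of _ i Mg] Mg A_sub
      by (intro rec int_dist) (force simp: \<phi>_def \<gamma>_def)+
    then show ?thesis by (simp add: algebra_simps)
  qed
  moreover have "0 \<le> a i" for i
    by (simp add: a_def set_lebesgue_integral_def)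
  moreover have "0 \<le> q" using \<gamma> c_pos by (simp add: q)
  ultimately have *: "b n \<le> b 0 - ((1 - q) powi (- int n) - 1) * a n"
      "a n \<le> (half_power (1 - q) n)\<^sup>2 * a 0"
    using contraction_telescope[of n a q b] by auto
  have an: "a n = (LINT w:A|M. (infdist (xk w) S)\<^sup>2)" and bn: "b n = (LINT w:A|M. (norm (xk w - x))\<^sup>2)"
    unfolding a_def b_def using A_sub A_M by (auto intro!: set_lebesgue_integral_cong simp: xk_z)
  show ?b ?a
    using * unfolding an bn by (simp_all add: a_def b_def z_0)
qed

text \<open>The event \<open>E\<close> belongs to \<open>H 0\<close>. Multiplication by its
  indicator \<open>I\<close> makes all functions integrable, commutes with the conditional
  expectation, and changes nothing on \<open>E\<close>.\<close>

lemma cond_exp_bounds_local: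
  fixes Mg :: real
  defines "q \<equiv> \<beta> * (2 - \<beta>) / (c * Mg\<^sup>2)"
  assumes Mg: "\<And>w i. w \<in> space M \<Longrightarrow> i < N w \<Longrightarrow> norm (d (Suc i) w) \<le> Mg"
    and x: "x \<in> S"
  shows "AE w in M. N w = n \<and> norm (v w - x) \<le> R \<longrightarrow>
      real_cond_exp M (H 0) (\<lambda>w. (norm (xk w - x))\<^sup>2) w \<le> (norm (v w - x))\<^sup>2
         - ((1 - q) powi (- int n) - 1) * real_cond_exp M (H 0) (\<lambda>w. (infdist (xk w) S)\<^sup>2) w
    \<and> real_cond_exp M (H 0) (\<lambda>w. infdist (xk w) S) w \<le> half_power (1 - q) n * norm (v w - x)"
proof -
  interpret F: finite_measure_subalgebra M "H 0"
    by standard (rule H)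
  define E where "E = {w \<in> space (H 0). N w = n \<and> norm (v w - x) \<le> R}"
  have E[measurable]: "E \<in> sets (H 0)" unfolding E_def using v_meas N_meas by measurable
  have EM[measurable]: "E \<in> sets M" by (rule sets_0_M[OF E])
  define \<kappa> where "\<kappa> = (1 - q) powi (- int n) - 1"
  define \<eta> where "\<eta> = half_power (1 - q) n"
  have \<eta>0: "0 \<le> \<eta>" by (simp add: \<eta>_def half_power_def)
  define I where "I = (indicator E :: 'w \<Rightarrow> real)"
  define rv rf rh re where "rv w = (norm (v w - x))\<^sup>2" and "rf w = (norm (xk w - x))\<^sup>2"
    and "rh w = (infdist (xk w) S)\<^sup>2" and "re w = infdist (xk w) S" for w
  have R: "norm (xk w - x) \<le> R" "infdist (xk w) S \<le> R" "norm (v w - x) \<le> R" if "w \<in> E" for w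
    using that norm_z_le[of w n x] infdist_le_norm[OF x, of "xk w"] x
    by (auto simp: E_def space_H xk_z)
  have rv_H[measurable]: "rv \<in> borel_measurable (H 0)"
    unfolding rv_def[abs_def] using v_meas by measurable
  have rv_M[measurable]: "rv \<in> borel_measurable M" by (rule measurable_from_subalg[OF H rv_H])
  have meas[measurable]: "rf \<in> borel_measurable M" "rh \<in> borel_measurable M" "re \<in> borel_measurable M"
    unfolding rf_def[abs_def] rh_def[abs_def] re_def[abs_def] using xk_meas infdist_meas by measurable
  have Im[measurable]: "I \<in> borel_measurable (H 0)" unfolding I_def by measurable
  have int: "integrable M (\<lambda>w. I w * f w)" if "\<And>w. w \<in> E \<Longrightarrow> \<bar>f w\<bar> \<le> B" "f \<in> borel_measurable M" for f B
    using set_integrable_bounded[OF EM that(2,1)] by (simp add: set_integrable_def I_def)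
  have int_v: "integrable M (\<lambda>w. I w * rv w)"
    using R by (intro int[of _ "R\<^sup>2"] rv_M) (auto simp: rv_def intro!: power_mono)
  have int_f: "integrable M (\<lambda>w. I w * rf w)"
    using R by (intro int[of _ "R\<^sup>2"] meas) (auto simp: rf_def intro!: power_mono)
  have int_h: "integrable M (\<lambda>w. I w * rh w)"
    using R by (intro int[of _ "R\<^sup>2"] meas) (auto simp: rh_def infdist_nonneg intro!: power_mono)
  have int_e: "integrable M (\<lambda>w. I w * re w)"
    using R by (intro int[of _ R] meas) (auto simp: re_def infdist_nonneg)
  have LI: "(LINT w:A|M. I w * f w) = (LINT w:A \<inter> E|M. f w)" for A and f :: "'w \<Rightarrow> real"
    unfolding set_lebesgue_integral_def I_def
    by (intro Bochner_Integration.integral_cong) (auto simp: indicator_def)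
  have sub: "A \<inter> E \<subseteq> {w \<in> space M. N w = n \<and> norm (v w - x) \<le> R}" for A
    by (auto simp: E_def space_H)
  have sint: "set_integrable M A f" if "integrable M f" "A \<in> sets (H 0)" for A and f :: "'w \<Rightarrow> real"
    unfolding set_integrable_def using sets_0_M[OF that(2)] that(1)
    by (intro integrable_mult_indicator)
  \<comment> \<open>Integrating against \<open>I\<close> over \<open>A\<close> means integrating
    over \<open>A \<inter> E\<close>, an event to which \<open>integral_bounds\<close> applies;
    there \<open>N w = n\<close>, so \<open>\<kappa>\<close> is a constant.\<close>
  have le1: "AE w in M. real_cond_exp M (H 0) (\<lambda>w. I w * rf w) w
      \<le> real_cond_exp M (H 0) (\<lambda>w. I w * rv w - \<kappa> * (I w * rh w)) w"
  proof (rule F.real_cond_exp_mono_set_integral)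
    fix A assume A: "A \<in> sets (H 0)"
    show "(LINT w:A|M. I w * rf w) \<le> (LINT w:A|M. I w * rv w - \<kappa> * (I w * rh w))"
      using integral_bounds(1)[OF Mg x _ sub[of A], folded q_def \<kappa>_def] A
      by (subst set_integral_diff(2)[OF sint[OF int_v A] sint[OF integrable_mult_right[OF int_h] A]])
         (simp add: LI rv_def[symmetric] rf_def[symmetric] rh_def[symmetric])
  qed (intro int_f int_v int_h Bochner_Integration.integrable_diff integrable_mult_right)+
  have le2: "AE w in M. real_cond_exp M (H 0) (\<lambda>w. I w * rh w) w
      \<le> real_cond_exp M (H 0) (\<lambda>w. \<eta>\<^sup>2 * (I w * rv w)) w"
  proof (rule F.real_cond_exp_mono_set_integral)
    fix A assume A: "A \<in> sets (H 0)"
    have AE: "A \<inter> E \<in> sets (H 0)" using A by simp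
    have "(LINT w:A \<inter> E|M. rh w) \<le> \<eta>\<^sup>2 * (LINT w:A \<inter> E|M. (infdist (v w) S)\<^sup>2)"
      using integral_bounds(2)[OF Mg x AE sub[of A], folded q_def \<eta>_def] by (simp add: rh_def)
    also have "(LINT w:A \<inter> E|M. (infdist (v w) S)\<^sup>2) \<le> (LINT w:A \<inter> E|M. rv w)"
    proof (rule set_integral_mono)
      have v_M[measurable]: "v \<in> borel_measurable M" by (rule measurable_from_subalg[OF H v_meas])
      have le: "(infdist (v w) S)\<^sup>2 \<le> rv w" for w
        unfolding rv_def by (intro power_mono infdist_le_norm x infdist_nonneg)
      have le_R: "rv w \<le> R\<^sup>2" if "w \<in> A \<inter> E" for w
        using R(3)[of w] that unfolding rv_def by (intro power_mono) auto
      show "set_integrable M (A \<inter> E) (\<lambda>w. (infdist (v w) S)\<^sup>2)"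
        by (rule set_integrable_bounded[OF sets_0_M[OF AE], of _ "R\<^sup>2"])
           (use order_trans[OF le le_R] in \<open>auto simp: infdist_nonneg\<close>)
      show "set_integrable M (A \<inter> E) rv"
        by (rule set_integrable_bounded[OF sets_0_M[OF AE] rv_M, of "R\<^sup>2"])
           (use le_R in \<open>auto simp: rv_def\<close>)
      show "(infdist (v w) S)\<^sup>2 \<le> rv w" for w by (rule le)
    qed
    finally show "(LINT w:A|M. I w * rh w) \<le> (LINT w:A|M. \<eta>\<^sup>2 * (I w * rv w))"
      by (simp add: LI mult_left_mono)
  qed (intro int_v int_h integrable_mult_right)+
  \<comment> \<open>The bound on the expected distance is the square root of the bound on the
    expected squared distance, by conditional Jensen; \<open>I\<close> equals its own
    square.\<close>
  have jensen: "AE w in M. (real_cond_exp M (H 0) (\<lambda>w. I w * re w) w)\<^sup>2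
      \<le> real_cond_exp M (H 0) (\<lambda>w. I w * rh w) w"
  proof -
    have "(\<lambda>w. (I w * re w)\<^sup>2) = (\<lambda>w. I w * rh w)"
      by (auto simp: I_def re_def rh_def indicator_def)
    then show ?thesis
      using F.real_cond_exp_jensens_inequality(2)[OF int_e, of UNIV _ _ "\<lambda>t. t\<^sup>2"] int_h
      by (simp add: convex_power2)
  qed
  \<comment> \<open>Only the products with \<open>I\<close> have to be integrable here, so the
    conditional expectations of the unlocalized functions are controlled on \<open>E\<close> even if
    those functions are not integrable.\<close>
  note mult = F.real_cond_exp_mult[OF Im meas(1) int_f] F.real_cond_exp_mult[OF Im meas(2) int_h]
    F.real_cond_exp_mult[OF Im meas(3) int_e]
  have "AE w in M. real_cond_exp M (H 0) (\<lambda>w. I w * rv w) w = I w * rv w"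
    by (rule F.real_cond_exp_F_meas[OF int_v]) measurable
  then show ?thesis
    using le1 le2 jensen mult F.real_cond_exp_cmult[OF int_v, of "\<eta>\<^sup>2"]
      F.real_cond_exp_diff[OF int_v integrable_mult_right[OF int_h, of \<kappa>]]
      F.real_cond_exp_cmult[OF int_h, of \<kappa>] AE_space
  proof eventually_elim
    case (elim w)
    show ?case
    proof (intro impI)
      assume "N w = n \<and> norm (v w - x) \<le> R"
      then have I1: "I w = 1" using elim by (simp add: I_def E_def space_H)
      have 1: "real_cond_exp M (H 0) rf w \<le> rv w - \<kappa> * real_cond_exp M (H 0) rh w"
        using elim I1 by simp
      have "(real_cond_exp M (H 0) re w)\<^sup>2 \<le> \<eta>\<^sup>2 * rv w"
        using elim I1 by simp
      also have "\<dots> = (\<eta> * norm (v w - x))\<^sup>2" by (simp add: rv_def power_mult_distrib)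
      finally have "real_cond_exp M (H 0) re w \<le> \<eta> * norm (v w - x)"
        by (rule power2_le_imp_le) (simp add: \<eta>0)
      with 1 show "real_cond_exp M (H 0) (\<lambda>w. (norm (xk w - x))\<^sup>2) w \<le> (norm (v w - x))\<^sup>2
         - ((1 - q) powi (- int n) - 1) * real_cond_exp M (H 0) (\<lambda>w. (infdist (xk w) S)\<^sup>2) w
        \<and> real_cond_exp M (H 0) (\<lambda>w. infdist (xk w) S) w \<le> half_power (1 - q) n * norm (v w - x)"
        by (simp add: rv_def rf_def[abs_def] rh_def[abs_def] re_def[abs_def] \<kappa>_def \<eta>_def)
    qed
  qed
qed

text \<open>The events \<open>N w = n\<close> and \<open>norm (v w - x) \<le> real l\<close> form a
  countable cover of the space, so their exceptional null sets can be united.\<close>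

lemma cond_exp_bounds:
  fixes Mg :: real
  defines "q \<equiv> \<beta> * (2 - \<beta>) / (c * Mg\<^sup>2)"
  assumes Mg: "\<And>w i. w \<in> space M \<Longrightarrow> i < N w \<Longrightarrow> norm (d (Suc i) w) \<le> Mg"
    and x: "x \<in> S"
  shows "AE w in M.
      real_cond_exp M (H 0) (\<lambda>w. (norm (xk w - x))\<^sup>2) w \<le> (norm (v w - x))\<^sup>2
         - ((1 - q) powi (- int (N w)) - 1) * real_cond_exp M (H 0) (\<lambda>w. (infdist (xk w) S)\<^sup>2) w
    \<and> real_cond_exp M (H 0) (\<lambda>w. infdist (xk w) S) w \<le> half_power (1 - q) (N w) * norm (v w - x)"
proof -
  have "AE w in M. \<forall>n (l::nat). N w = n \<and> norm (v w - x) \<le> real l \<longrightarrow>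
      real_cond_exp M (H 0) (\<lambda>w. (norm (xk w - x))\<^sup>2) w \<le> (norm (v w - x))\<^sup>2
         - ((1 - q) powi (- int n) - 1) * real_cond_exp M (H 0) (\<lambda>w. (infdist (xk w) S)\<^sup>2) w
    \<and> real_cond_exp M (H 0) (\<lambda>w. infdist (xk w) S) w \<le> half_power (1 - q) n * norm (v w - x)"
    unfolding AE_all_countable q_def using cond_exp_bounds_local[OF Mg x] by blast
  then show ?thesis
  proof eventually_elim
    case (elim w)
    obtain l :: nat where "norm (v w - x) \<le> real l" using real_arch_simple by blast
    with elim show ?case by blast
  qed
qed

end

section \<open>The concrete histories as sub-sigma-algebras\<close>

lemma space_ext_history [simp]: "space (ext_history M x0 N s k) = space M"
  by (simp add: ext_history_def space_measure_of_conv)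

lemma space_inner_history [simp]: "space (inner_history M x0 N s k i) = space M"
  by (simp add: inner_history_def space_measure_of_conv)

lemma space_outer_history [simp]: "space (outer_history M x0 N s k) = space M"
  by (simp add: outer_history_def space_measure_of_conv)

lemma subalgebra_sigma:
  assumes "G \<subseteq> sets M"
  shows "subalgebra M (sigma (space M) G)"
  using sets.sigma_sets_subset[OF assms] order_trans[OF assms sets.space_closed]
  by (simp add: subalgebra_def space_measure_of_conv)

lemma sets_sigma_mono:
  assumes "G \<subseteq> G'" "G' \<subseteq> Pow \<Omega>"
  shows "sets (sigma \<Omega> G) \<subseteq> sets (sigma \<Omega> G')"
  unfolding sets_measure_of[OF assms(2)] sets_measure_of[OF order_trans[OF assms]]
  by (rule sigma_sets_mono'[OF assms(1)])

lemma subalgebra_outer_history: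
  assumes "x0 \<in> borel_measurable M"
    and N: "\<And>k. 1 \<le> k \<Longrightarrow> N k \<in> measurable M (count_space UNIV)"
    and s: "\<And>k i. 1 \<le> k \<Longrightarrow> 1 \<le> i \<Longrightarrow> s k i \<in> measurable M (count_space UNIV)"
  shows "subalgebra M (outer_history M x0 N s k)"
  unfolding outer_history_def
proof (rule subalgebra_sigma, intro Un_least subsetI)
  fix A assume "A \<in> {{w \<in> space M. i \<le> N t w \<and> s t i w = j} |t i j. 1 \<le> t \<and> t \<le> k \<and> 1 \<le> i}"
  then obtain t i j where "A = {w \<in> space M. i \<le> N t w \<and> s t i w = j}" and t: "1 \<le> t" "1 \<le> i"
    by blast
  with N[OF t(1)] s[OF t] show "A \<in> sets M" by simp
next
  fix A assume "A \<in> {{w \<in> space M. N t w = n} |t n. 1 \<le> t \<and> t \<le> k}"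
  then obtain t n where "A = {w \<in> space M. N t w = n}" "1 \<le> t" by blast
  with N[of t] show "A \<in> sets M" by simp
qed (use measurable_sets[OF assms(1)] in auto)

lemma subalgebra_ext_history:
  assumes "x0 \<in> borel_measurable M"
    and N: "\<And>k. 1 \<le> k \<Longrightarrow> N k \<in> measurable M (count_space UNIV)"
    and s: "\<And>k i. 1 \<le> k \<Longrightarrow> 1 \<le> i \<Longrightarrow> s k i \<in> measurable M (count_space UNIV)"
    and k: "1 \<le> k"
  shows "subalgebra M (ext_history M x0 N s k)"
proof -
  have "subalgebra M (outer_history M x0 N s (k - 1))"
    by (rule subalgebra_outer_history[OF assms(1) N s])
  then show ?thesis
    unfolding ext_history_def using N[OF k]
    by (intro subalgebra_sigma Un_least) (auto simp: subalgebra_def)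
qed

lemma subalgebra_inner_history:
  assumes "x0 \<in> borel_measurable M"
    and N: "\<And>k. 1 \<le> k \<Longrightarrow> N k \<in> measurable M (count_space UNIV)"
    and s: "\<And>k i. 1 \<le> k \<Longrightarrow> 1 \<le> i \<Longrightarrow> s k i \<in> measurable M (count_space UNIV)"
    and k: "1 \<le> k"
  shows "subalgebra M (inner_history M x0 N s k i)"
  unfolding inner_history_def
proof (rule subalgebra_sigma, intro Un_least)
  have "subalgebra M (ext_history M x0 N s k)"
    by (rule subalgebra_ext_history[OF assms(1) N s k])
  then show "sets (ext_history M x0 N s k) \<subseteq> sets M" by (simp add: subalgebra_def)
  show "{{w \<in> space M. s k l w = j} |l j. 1 \<le> l \<and> l \<le> i} \<subseteq> sets M"
  proof
    fix A assume "A \<in> {{w \<in> space M. s k l w = j} |l j. 1 \<le> l \<and> l \<le> i}"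
    then obtain l j where "A = {w \<in> space M. s k l w = j}" "1 \<le> l" by blast
    with s[OF k] show "A \<in> sets M" by simp
  qed
qed

lemma inner_history_gen:
  "sets (ext_history M x0 N s k) \<union> {{w \<in> space M. s k l w = j} |l j. 1 \<le> l \<and> l \<le> i} \<subseteq> Pow (space M)"
  using sets.space_closed[of "ext_history M x0 N s k"] by auto

lemma sets_inner_history_Suc:
  "sets (inner_history M x0 N s k i) \<subseteq> sets (inner_history M x0 N s k (Suc i))"
  unfolding inner_history_def
  by (rule sets_sigma_mono[OF Un_mono inner_history_gen]) (blast intro: le_SucI)+

text \<open>Equality as measures, with \<open>sigma\<close> carrying the zero measure on both sides,
  allows conditional expectations given the initial history to be rewritten directly.\<close>

lemma inner_history_0: "inner_history M x0 N s k 0 = ext_history M x0 N s k"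
proof (rule measure_eqI)
  have "sets (inner_history M x0 N s k 0) = sigma_sets (space M)
      (sets (ext_history M x0 N s k) \<union> {{w \<in> space M. s k l w = j} |l j. 1 \<le> l \<and> l \<le> 0})"
    unfolding inner_history_def by (rule sets_measure_of[OF inner_history_gen])
  also have "\<dots> = sigma_sets (space (ext_history M x0 N s k)) (sets (ext_history M x0 N s k))"
    by simp
  also have "\<dots> = sets (ext_history M x0 N s k)"
    by (rule sets.sigma_sets_eq)
  finally show "sets (inner_history M x0 N s k 0) = sets (ext_history M x0 N s k)" .
qed (simp add: inner_history_def ext_history_def emeasure_sigma)

lemma measurable_inner_history_sample:
  assumes "1 \<le> l" "l \<le> i"
  shows "s k l \<in> measurable (inner_history M x0 N s k i) (count_space UNIV)"
proof (subst measurable_count_space_eq2_countable, intro conjI ballI)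
  fix j
  have "s k l -` {j} \<inter> space (inner_history M x0 N s k i) = {w \<in> space M. s k l w = j}"
    by auto
  also have "\<dots> \<in> sets (inner_history M x0 N s k i)"
    unfolding inner_history_def sets_measure_of[OF inner_history_gen]
    by (rule sigma_sets.Basic) (use assms in blast)
  finally show "s k l -` {j} \<inter> space (inner_history M x0 N s k i)
      \<in> sets (inner_history M x0 N s k i)" .
qed auto

lemma ext_history_gen:
  "sets (outer_history M x0 N s (k - 1)) \<union> {{w \<in> space M. N k w = n} |n. True} \<subseteq> Pow (space M)"
  using sets.space_closed[of "outer_history M x0 N s (k - 1)"] by auto

lemma measurable_ext_history_sample_size:
  "N k \<in> measurable (ext_history M x0 N s k) (count_space UNIV)"
proof (subst measurable_count_space_eq2_countable, intro conjI ballI)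
  fix n
  have "N k -` {n} \<inter> space (ext_history M x0 N s k) = {w \<in> space M. N k w = n}"
    by auto
  also have "\<dots> \<in> sets (ext_history M x0 N s k)"
    unfolding ext_history_def sets_measure_of[OF ext_history_gen]
    by (rule sigma_sets.Basic) blast
  finally show "N k -` {n} \<inter> space (ext_history M x0 N s k) \<in> sets (ext_history M x0 N s k)" .
qed auto

text \<open>Carries the measurability of \<open>v k\<close> from the outer history over to the
  initial history of the inner run.\<close>

lemma subalgebra_ext_outer:
  "subalgebra (ext_history M x0 N s k) (outer_history M x0 N s (k - 1))"
proof -
  have "sets (ext_history M x0 N s k) = sigma_sets (space M)
      (sets (outer_history M x0 N s (k - 1)) \<union> {{w \<in> space M. N k w = n} |n. True})"
    unfolding ext_history_def by (rule sets_measure_of[OF ext_history_gen])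
  then show ?thesis by (simp add: subalgebra_def subset_iff sigma_sets.Basic)
qed

section \<open>From a single run to all outer iterations\<close>

theorem lemma3p1:
  fixes g :: "nat \<Rightarrow> real ^ 'n \<Rightarrow> real"
    and m :: nat
    and X Y :: "(real ^ 'n) set"
    and p :: "nat pmf"
    and c \<beta> :: real
    and M :: "'w measure"
    and x0 :: "'w \<Rightarrow> real ^ 'n"
    and N :: "nat \<Rightarrow> 'w \<Rightarrow> nat"
    and s :: "nat \<Rightarrow> nat \<Rightarrow> 'w \<Rightarrow> nat"
    and d :: "nat \<Rightarrow> nat \<Rightarrow> 'w \<Rightarrow> real ^ 'n"
    and v xk :: "nat \<Rightarrow> 'w \<Rightarrow> real ^ 'n"
    and z :: "nat \<Rightarrow> nat \<Rightarrow> 'w \<Rightarrow> real ^ 'n"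
  assumes g_convex: "\<forall>i\<in>{1..m}. convex_on UNIV (g i)"
    and Y: "closed Y" "convex Y"
    and X_eq: "X = (\<Inter>i\<in>{1..m}. {x. g i x \<le> 0})"
    and feasible: "X \<inter> Y \<noteq> {}"
    and p_support: "set_pmf p = {1..m}"
    and c_pos: "c > 0"
    and regularity: "\<forall>x\<in>Y. (infdist x (X \<inter> Y))\<^sup>2
          \<le> c * measure_pmf.expectation p (\<lambda>i. (pos_part (g i) x)\<^sup>2)"
    and step: "0 < \<beta>" "\<beta> < 2"
    and prob: "prob_space M"
    and x0_meas: "x0 \<in> borel_measurable M"
    and x0_in: "\<forall>w\<in>space M. x0 w \<in> Y"
    and x0_int: "integrable M (\<lambda>w. norm (x0 w))"
    and N_meas: "\<forall>k\<ge>1. N k \<in> measurable M (count_space UNIV)"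
    and s_meas: "\<forall>k\<ge>1. \<forall>i\<ge>1. s k i \<in> measurable M (count_space UNIV)"
    and s_range: "\<forall>k\<ge>1. \<forall>i\<ge>1. \<forall>w\<in>space M. s k i w \<in> {1..m}"
    and s_distr: "\<forall>k\<ge>1. \<forall>i\<ge>1. distr M (count_space UNIV) (s k i) = measure_pmf p"
    and s_indep: "\<forall>k\<ge>1. \<forall>i\<ge>1. prob_space.indep_set M
          (sets (inner_history M x0 N s k (i - 1)))
          (sets (vimage_algebra (space M) (s k i) (count_space UNIV)))"
    and v_meas: "\<forall>k\<ge>1. v k \<in> borel_measurable (outer_history M x0 N s (k - 1))"
    and v_in: "\<forall>k\<ge>1. \<forall>w\<in>space M. v k w \<in> Y"
    and z_eq: "\<forall>k\<ge>1. \<forall>i. \<forall>w\<in>space M.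
          z k i w = feas_iter Y g \<beta> (v k w) (\<lambda>l. s k l w) (\<lambda>l. d k l w) i"
    and d_meas: "\<forall>k\<ge>1. \<forall>i\<ge>1. d k i \<in> borel_measurable (inner_history M x0 N s k i)"
    and d_subgrad: "\<forall>k\<ge>1. \<forall>w\<in>space M. \<forall>i\<in>{1..N k w}.
          d k i w \<in> subdifferential (pos_part (g (s k i w))) (z k (i - 1) w)"
    and xk_eq: "\<forall>k\<ge>1. \<forall>w\<in>space M. xk k w = z k (N k w) w"
  shows "\<forall>x\<in>X \<inter> Y.
      (\<forall>k\<ge>1. \<forall>w\<in>space M. (norm (xk k w - x))\<^sup>2 \<le> (norm (v k w - x))\<^sup>2)
      \<and> (\<forall>Mg::real.
          (\<forall>k\<ge>1. \<forall>w\<in>space M. \<forall>i\<in>{1..N k w}. norm (d k i w) \<le> Mg) \<longrightarrow>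
          (let q = \<beta> * (2 - \<beta>) / (c * Mg\<^sup>2) in
            AE w in M. \<forall>k\<ge>1.
              real_cond_exp M (ext_history M x0 N s k) (\<lambda>w. (norm (xk k w - x))\<^sup>2) w
                \<le> (norm (v k w - x))\<^sup>2
                   - ((1 - q) powi (- int (N k w)) - 1)
                     * real_cond_exp M (ext_history M x0 N s k)
                         (\<lambda>w. (infdist (xk k w) (X \<inter> Y))\<^sup>2) w
              \<and> real_cond_exp M (ext_history M x0 N s k)
                  (\<lambda>w. infdist (xk k w) (X \<inter> Y)) w
                \<le> half_power (1 - q) (N k w) * norm (v k w - x)))"
proof -
  define S where "S = X \<inter> Y"
  interpret prob_space M by (rule prob)
  have N: "N k \<in> measurable M (count_space UNIV)" if "1 \<le> k" for k
    using N_meas that by blast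
  have s: "s k i \<in> measurable M (count_space UNIV)" if "1 \<le> k" "1 \<le> i" for k i
    using s_meas that by blast
  have run: "feasibility_run M (inner_history M x0 N s k) g {1..m} (pmf p) Y S c \<beta>
      (N k) (s k) (d k) (v k) (xk k)" if k: "1 \<le> k" for k
  proof
    show "convex_on UNIV (g j)" if "j \<in> {1..m}" for j using g_convex that by blast
    show "S = {x \<in> Y. \<forall>j\<in>{1..m}. g j x \<le> 0}" by (auto simp: S_def X_eq)
    show "S \<noteq> {}" using feasible by (simp add: S_def)
    \<comment> \<open>The expectation under \<open>p\<close> is a finite sum because
      \<open>p\<close> is supported on \<open>{1..m}\<close>; its weights are also the sampling
      probabilities.\<close>
    show "(infdist x S)\<^sup>2 \<le> c * (\<Sum>j\<in>{1..m}. pmf p j * (pos_part (g j) x)\<^sup>2)" if "x \<in> Y" for x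
    proof -
      have "measure_pmf.expectation p (\<lambda>j. (pos_part (g j) x)\<^sup>2)
          = (\<Sum>j\<in>{1..m}. (pos_part (g j) x)\<^sup>2 * pmf p j)"
        using p_support by (intro integral_measure_pmf_real) auto
      with regularity[rule_format, OF that] show ?thesis by (simp add: S_def mult.commute)
    qed
    show "subalgebra M (inner_history M x0 N s k i)" for i
      by (rule subalgebra_inner_history[OF x0_meas N s k])
    show "sets (inner_history M x0 N s k i) \<subseteq> sets (inner_history M x0 N s k (Suc i))" for i
      by (rule sets_inner_history_Suc)
    show "N k \<in> measurable (inner_history M x0 N s k 0) (count_space UNIV)"
      unfolding inner_history_0 by (rule measurable_ext_history_sample_size)
    show "v k \<in> borel_measurable (inner_history M x0 N s k 0)"
      unfolding inner_history_0
      by (rule measurable_from_subalg[OF subalgebra_ext_outer v_meas[rule_format, OF k]])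
    show "s k (Suc i) \<in> measurable (inner_history M x0 N s k (Suc i)) (count_space UNIV)" for i
      by (rule measurable_inner_history_sample) auto
    show "s k (Suc i) w \<in> {1..m}" if "w \<in> space M" for i w
      using s_range k that by simp
    show "prob {w \<in> space M. s k (Suc i) w = j} = pmf p j" for i j
    proof -
      have "pmf p j = measure (distr M (count_space UNIV) (s k (Suc i))) {j}"
        using s_distr k by (simp add: measure_pmf_single)
      also have "\<dots> = prob {w \<in> space M. s k (Suc i) w = j}"
        using s[OF k, of "Suc i"] by (subst measure_distr) (auto intro!: arg_cong[where f = prob])
      finally show ?thesis by simp
    qed
    show "indep_set (sets (inner_history M x0 N s k i))
        (sets (vimage_algebra (space M) (s k (Suc i)) (count_space UNIV)))" for i
      using s_indep[rule_format, OF k, of "Suc i"] by simp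
    show "d k (Suc i) \<in> borel_measurable (inner_history M x0 N s k (Suc i))" for i
      using d_meas k by simp
    \<comment> \<open>Index shift: the inner steps from 1 to \<open>N k w\<close> are
      \<open>Suc i\<close> with \<open>i < N k w\<close>, and the subgradient of step
      \<open>Suc i\<close> is taken at \<open>z k i w\<close>.\<close>
    show "d k (Suc i) w \<in> subdifferential (pos_part (g (s k (Suc i) w)))
        (feas_iter Y g \<beta> (v k w) (\<lambda>l. s k l w) (\<lambda>l. d k l w) i)" if "w \<in> space M" "i < N k w" for i w
      using d_subgrad[rule_format, OF k that(1), of "Suc i"] z_eq[rule_format, OF k that(1), of i] that
      by simp
    show "xk k w = feas_iter Y g \<beta> (v k w) (\<lambda>l. s k l w) (\<lambda>l. d k l w) (N k w)"
      if "w \<in> space M" for w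
      using xk_eq z_eq k that by simp
  qed (use Y c_pos step v_in k in auto)
  have sure: "(norm (xk k w - x))\<^sup>2 \<le> (norm (v k w - x))\<^sup>2"
    if "x \<in> S" "1 \<le> k" "w \<in> space M" for x k w
  proof -
    interpret feasibility_run M "inner_history M x0 N s k" g "{1..m}" "pmf p" Y S c \<beta>
      "N k" "s k" "d k" "v k" "xk k" by (rule run[OF that(2)])
    show ?thesis
      using norm_z_le[OF that(3) order_refl that(1)] that(3) by (simp add: xk_z power_mono)
  qed
  have ae: "AE w in M. \<forall>k\<ge>1.
        real_cond_exp M (ext_history M x0 N s k) (\<lambda>w. (norm (xk k w - x))\<^sup>2) w
          \<le> (norm (v k w - x))\<^sup>2
             - ((1 - \<beta> * (2 - \<beta>) / (c * Mg\<^sup>2)) powi (- int (N k w)) - 1)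
               * real_cond_exp M (ext_history M x0 N s k) (\<lambda>w. (infdist (xk k w) S)\<^sup>2) w
        \<and> real_cond_exp M (ext_history M x0 N s k) (\<lambda>w. infdist (xk k w) S) w
          \<le> half_power (1 - \<beta> * (2 - \<beta>) / (c * Mg\<^sup>2)) (N k w) * norm (v k w - x)"
    if x: "x \<in> S"
      and Mg: "\<forall>k\<ge>1. \<forall>w\<in>space M. \<forall>i\<in>{1..N k w}. norm (d k i w) \<le> Mg" for x Mg
    \<comment> \<open>There are countably many outer iterations, so one null set serves all
      \<open>k\<close>.\<close>
    unfolding AE_all_countable
  proof (intro allI AE_impI)
    fix k :: nat assume k: "1 \<le> k"
    interpret feasibility_run M "inner_history M x0 N s k" g "{1..m}" "pmf p" Y S c \<beta>
      "N k" "s k" "d k" "v k" "xk k" by (rule run[OF k])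
    have "norm (d k (Suc i) w) \<le> Mg" if "w \<in> space M" "i < N k w" for i w
      using Mg k that by simp
    from cond_exp_bounds[OF this x, unfolded inner_history_0]
    show "AE w in M. real_cond_exp M (ext_history M x0 N s k) (\<lambda>w. (norm (xk k w - x))\<^sup>2) w
          \<le> (norm (v k w - x))\<^sup>2
             - ((1 - \<beta> * (2 - \<beta>) / (c * Mg\<^sup>2)) powi (- int (N k w)) - 1)
               * real_cond_exp M (ext_history M x0 N s k) (\<lambda>w. (infdist (xk k w) S)\<^sup>2) w
        \<and> real_cond_exp M (ext_history M x0 N s k) (\<lambda>w. infdist (xk k w) S) w
          \<le> half_power (1 - \<beta> * (2 - \<beta>) / (c * Mg\<^sup>2)) (N k w) * norm (v k w - x)" .
  qed
  show ?thesis
    unfolding Let_def S_def[symmetric]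
    by (intro ballI conjI allI impI) (fact sure, fact ae)
qed

end
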